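(* Let $\{\tilde{\mathbf{x}}^{(k)}\}=\{(1,(\mathbf{x}^{(k)})^\top)^\top\}$ be the sequence generated by the enhanced BIM algorithm (described in the context). If $\alpha\ge\|\mathcal{T}_f\|$, then the following hold. (i) The sequence $\{f_\alpha(\mathbf{x}^{(k)})\}$ is strictly decreasing. (ii) Any cluster point of $\{\mathbf{x}^{(k)}\}$ is a KKT point of the problem $\min_{\mathbf{x}\in\mathbb{R}^n}f_\alpha(\mathbf{x})=\mathcal{T}_f\tilde{\mathbf{x}}^4-\alpha\|\tilde{\mathbf{x}}\|^4$ subject to $\|\mathbf{x}\|=1$. (iii) If $f_\alpha(\mathbf{x})$ is strictly concave, then $\|\mathbf{x}^{(k+1)}-\mathbf{x}^{(k)}\|\to0$ as $k\to\infty$.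
   Context: Setting. $n\ge2$, $\theta>0$, $B=(b_{ij})$ is a real symmetric $n\times n$ matrix with positive diagonal entries and nonpositive off-diagonal entries, and $f(\mathbf{x})=\frac{\theta}{2}\sum_{i=1}^n x_i^4+\mathbf{x}^\top B\mathbf{x}$ for $\mathbf{x}\in\mathbb{R}^n$. For $\mathbf{x}\in\mathbb{R}^n$ put $\tilde{\mathbf{x}}=(1,\mathbf{x}^\top)^\top\in\mathbb{R}^{n+1}$. $\mathcal{T}_f$ is the unique symmetric real fourth-order $(n+1)$-dimensional tensor (indices $0,\dots,n$) such that $\mathcal{T}_f\tilde{\mathbf{u}}^4=\frac{\theta}{2}\sum_{i=1}^n u_i^4+u_0^2\sum_{i,j=1}^n b_{ij}u_iu_j$ for all $\tilde{\mathbf{u}}=(u_0,\dots,u_n)^\top\in\mathbb{R}^{n+1}$; thus $f(\mathbf{x})=\mathcal{T}_f\tilde{\mathbf{x}}^4$. Here $\mathcal{T}pqrs=\sum \mathcal{T}_{ijkl}p_iq_jr_ks_l$, $\mathcal{T}p^4=\mathcal{T}pppp$, $\|\mathcal{T}\|$ is the Frobenius norm (square root of the sum of squared entries), and $\|\cdot\|$, $\langle\cdot,\cdot\rangle$ are Euclidean. $f_\alpha(\mathbf{x})=\mathcal{T}_f\tilde{\mathbf{x}}^4-\alpha\|\tilde{\mathbf{x}}\|^4$ is regarded as a function of $\mathbf{x}\in\mathbb{R}^n$ with gradient $\nabla_{\mathbf{x}}f_\alpha$. A KKT point of $\min f_\alpha(\mathbf{x})$ s.t. $\|\mathbf{x}\|=1$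 is a unit vector $\mathbf{x}^*$ for which there is $\lambda^*\in\mathbb{R}$ with $\nabla_{\mathbf{x}}f_\alpha(\mathbf{x}^* )=2\lambda^*\mathbf{x}^*$. Enhanced BIM algorithm. Take $\mathbf{x}^{(0)}=\mathbf{u}^*$, where $\mathbf{u}^*$ is the unit vector returned by the PAM algorithm below. For $k=0,1,2,\dots$ set $\mathbf{x}^{(k+1)}=\mathbf{x}^{(k)}$ if $\nabla_{\mathbf{x}}f_\alpha(\mathbf{x}^{(k)})=\mathbf{0}$, and $\mathbf{x}^{(k+1)}=-\nabla_{\mathbf{x}}f_\alpha(\mathbf{x}^{(k)})/\|\nabla_{\mathbf{x}}f_\alpha(\mathbf{x}^{(k)})\|$ otherwise. The iteration is run indefinitely. PAM algorithm. Let $F_\alpha(\mathbf{x},\mathbf{y},\mathbf{z},\mathbf{w})=\mathcal{T}_f\tilde{\mathbf{x}}\tilde{\mathbf{y}}\tilde{\mathbf{z}}\tilde{\mathbf{w}}-\alpha\langle\tilde{\mathbf{x}},\tilde{\mathbf{y}}\rangle\langle\tilde{\mathbf{z}},\tilde{\mathbf{w}}\rangle$ and $\mathbb{G}=\{(1,\mathbf{x}^\top)^\top:\mathbf{x}\in\mathbb{R}^n,\|\mathbf{x}\|=1\}$. Given $\epsilon>0$, $\gamma_1,\dots,\gamma_4\ge0$ and initial points $\tilde{\mathbf{x}}^{(0)},\tilde{\mathbf{y}}^{(0)},\tilde{\mathbf{z}}^{(0)},\tilde{\mathbf{w}}^{(0)}\in\mathbb{G}$ (iterates here are distinct from those of the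 BIM algorithm), at step $k=0,1,2,\dots$ update the blocks $\tilde{\mathbf{x}},\tilde{\mathbf{y}},\tilde{\mathbf{z}},\tilde{\mathbf{w}}$ in this order, each time replacing the current block by a minimizer over $\mathbb{G}$ of $F_\alpha$ (other blocks fixed at their most recent values) plus $\frac{\gamma_i}{2}$ times the squared Euclidean distance to the previous value of that block ($i=1,2,3,4$ for $\mathbf{x},\mathbf{y},\mathbf{z},\mathbf{w}$). Let $\mathbf{u}^{(k+1)}$ be one of $\mathbf{x}^{(k+1)},\mathbf{y}^{(k+1)},\mathbf{z}^{(k+1)},\mathbf{w}^{(k+1)}$ with smallest value of $f_\alpha$ (and $\mathbf{u}^{(0)}$ likewise from the initial blocks). Stop and return $\mathbf{u}^*=\mathbf{u}^{(k+1)}$ as soon as $|f_\alpha(\mathbf{u}^{(k+1)})-f_\alpha(\mathbf{u}^{(k)})|\le\epsilon$.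
   Formalization: In (i), strict decrease is claimed only for steps with x^(k+1) ≠ x^(k): the iteration runs indefinitely and may be constant (e.g. B = bI with all initial points (1,e_1)), where strict decrease fails. *)

theory Defs
  imports "HOL-Analysis.Analysis"
begin

section \<open>Fourth-order tensors\<close>

text \<open>The library norm of the nested vector type below is the Frobenius norm, see
  \<open>norm_tensor4\<close>.\<close>

type_synonym 'm tensor4 = "real ^ 'm ^ 'm ^ 'm ^ 'm"

definition tensor_apply ::
    "'m::finite tensor4 \<Rightarrow> real ^ 'm \<Rightarrow> real ^ 'm \<Rightarrow> real ^ 'm \<Rightarrow> real ^ 'm \<Rightarrow> real" where
  "tensor_apply T p q r s =
     (\<Sum>i\<in>UNIV. \<Sum>j\<in>UNIV. \<Sum>k\<in>UNIV. \<Sum>l\<in>UNIV. T $ i $ j $ k $ l * p $ i * q $ j * r $ k * s $ l)"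

text \<open>The three adjacent transpositions generate all permutations of the four indices.\<close>

definition symmetric_tensor :: "'m::finite tensor4 \<Rightarrow> bool" where
  "symmetric_tensor T \<longleftrightarrow>
     (\<forall>i j k l. T $ i $ j $ k $ l = T $ j $ i $ k $ l \<and>
                T $ i $ j $ k $ l = T $ i $ k $ j $ l \<and>
                T $ i $ j $ k $ l = T $ i $ j $ l $ k)"

lemma norm_tensor4:
  "norm (T :: 'm::finite tensor4) =
     sqrt (\<Sum>i\<in>UNIV. \<Sum>j\<in>UNIV. \<Sum>k\<in>UNIV. \<Sum>l\<in>UNIV. (T $ i $ j $ k $ l)\<^sup>2)"
  by (simp add: norm_vec_def L2_set_def sum_nonneg)


section \<open>The tensor of the problem\<close>

text \<open>The index type \<open>'n option\<close> has \<open>n + 1\<close> elements: \<open>None\<close> is the index \<open>0\<close>, and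
  \<open>Some i\<close> are the indices \<open>1, \<dots>, n\<close>.\<close>

definition lift :: "real ^ 'n \<Rightarrow> real ^ ('n::finite option)" where
  "lift x = (\<chi> i. case i of None \<Rightarrow> 1 | Some j \<Rightarrow> x $ j)"

definition represents :: "real \<Rightarrow> real ^ 'n ^ 'n \<Rightarrow> ('n::finite option) tensor4 \<Rightarrow> bool" where
  "represents \<theta> B T \<longleftrightarrow>
     (\<forall>u. tensor_apply T u u u u =
        \<theta> / 2 * (\<Sum>i\<in>UNIV. (u $ Some i) ^ 4) +
        (u $ None)\<^sup>2 * (\<Sum>i\<in>UNIV. \<Sum>j\<in>UNIV. B $ i $ j * u $ Some i * u $ Some j))"

definition tensor_f :: "real \<Rightarrow> real ^ 'n ^ 'n \<Rightarrow> ('n::finite option) tensor4" where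
  "tensor_f \<theta> B = (THE T. symmetric_tensor T \<and> represents \<theta> B T)"

text \<open>The description in \<open>tensor_f\<close> is proper: such a tensor exists and is unique (by
  polarization).\<close>

lemma tensor_apply_add:
  "tensor_apply T (p + p') q r s = tensor_apply T p q r s + tensor_apply T p' q r s"
  "tensor_apply T p (q + q') r s = tensor_apply T p q r s + tensor_apply T p q' r s"
  "tensor_apply T p q (r + r') s = tensor_apply T p q r s + tensor_apply T p q r' s"
  "tensor_apply T p q r (s + s') = tensor_apply T p q r s + tensor_apply T p q r s'"
  by (simp_all add: tensor_apply_def algebra_simps sum.distrib)

lemma tensor_apply_commute:
  assumes "symmetric_tensor T"
  shows "tensor_apply T p q r s = tensor_apply T q p r s"
    and "tensor_apply T p q r s = tensor_apply T p r q s"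
    and "tensor_apply T p q r s = tensor_apply T p q s r"
proof -
  have s: "T $ i $ j $ k $ l = T $ j $ i $ k $ l" "T $ i $ j $ k $ l = T $ i $ k $ j $ l"
    "T $ i $ j $ k $ l = T $ i $ j $ l $ k" for i j k l
    using assms unfolding symmetric_tensor_def by blast+
  show "tensor_apply T p q r s = tensor_apply T q p r s"
    unfolding tensor_apply_def
    by (subst sum.swap) (intro sum.cong refl, subst s(1), simp add: mult_ac)
  show "tensor_apply T p q r s = tensor_apply T p r q s"
    unfolding tensor_apply_def
    by (rule sum.cong[OF refl], subst sum.swap) (intro sum.cong refl, subst s(2), simp add: mult_ac)
  show "tensor_apply T p q r s = tensor_apply T p q s r"
    unfolding tensor_apply_def
    by (rule sum.cong[OF refl], rule sum.cong[OF refl], subst sum.swap)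
      (intro sum.cong refl, subst s(3), simp add: mult_ac)
qed

lemma tensor_apply_polarization:
  assumes "symmetric_tensor T"
  defines "Q \<equiv> \<lambda>u. tensor_apply T u u u u"
  shows "24 * tensor_apply T p q r s =
    Q (p + q + r + s)
    - (Q (p + q + r) + Q (p + q + s) + Q (p + r + s) + Q (q + r + s))
    + (Q (p + q) + Q (p + r) + Q (p + s) + Q (q + r) + Q (q + s) + Q (r + s))
    - (Q p + Q q + Q r + Q s)"
proof -
  note c = tensor_apply_commute[OF assms(1)]
  have c': "tensor_apply T a b e d = tensor_apply T b a e d"
    "tensor_apply T a b e d = tensor_apply T a e b d"
    "tensor_apply T a b e d = tensor_apply T a b d e" for a b e d
    by (rule c)+
  show ?thesis
    unfolding Q_def by (simp add: tensor_apply_add c')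
qed

lemma tensor_apply_axis:
  "tensor_apply T (axis i 1) (axis j 1) (axis k 1) (axis l 1) = T $ i $ j $ k $ l"
proof -
  have *: "(\<Sum>a\<in>UNIV. g a * axis b 1 $ a) = (g b :: real)" for g and b :: 'a
    by (simp add: axis_def if_distrib[of "\<lambda>t. _ * t"] cong: if_cong)
  show ?thesis
    unfolding tensor_apply_def by (simp add: * flip: sum_distrib_right)
qed

lemma tensor_f_ex1:
  fixes B :: "real ^ 'n::finite ^ 'n"
  assumes "transpose B = B"
  shows "\<exists>!T. symmetric_tensor T \<and> represents \<theta> B T"
proof (rule ex_ex1I)
  define e :: "'n option \<Rightarrow> real" where "e = (\<lambda>i. if i = None then 1 else 0)"
  define b :: "'n option \<Rightarrow> 'n option \<Rightarrow> real" where
    "b = (\<lambda>i j. case i of None \<Rightarrow> 0 | Some i' \<Rightarrow> (case j of None \<Rightarrow> 0 | Some j' \<Rightarrow> B $ i' $ j'))"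
  define d :: "'n option \<Rightarrow> 'n option \<Rightarrow> 'n option \<Rightarrow> 'n option \<Rightarrow> real" where
    "d = (\<lambda>i j k l. if i \<noteq> None \<and> j = i \<and> k = i \<and> l = i then \<theta> / 2 else 0)"
  define T :: "('n option) tensor4" where
    "T = (\<chi> i j k l. d i j k l + (e i * e j * b k l + e i * e k * b j l + e i * e l * b j k
       + e j * e k * b i l + e j * e l * b i k + e k * e l * b i j) / 6)"
  have B: "B $ i $ j = B $ j $ i" for i j
    using assms by (metis transpose_def vec_lambda_beta)
  have bs: "b i j = b j i" for i j
    using B by (auto simp: b_def split: option.splits)
  have ds: "d i j k l = d j i k l" "d i j k l = d i k j l" "d i j k l = d i j l k" for i j k l
    by (auto simp: d_def)
  have "symmetric_tensor T"
    unfolding symmetric_tensor_def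
  proof (intro allI conjI)
    fix i j k l
    show "T $ i $ j $ k $ l = T $ j $ i $ k $ l"
      using ds(1)[of i j k l] bs[of i j] by (simp add: T_def)
    show "T $ i $ j $ k $ l = T $ i $ k $ j $ l"
      using ds(2)[of i j k l] bs[of j k] by (simp add: T_def)
    show "T $ i $ j $ k $ l = T $ i $ j $ l $ k"
      using ds(3)[of i j k l] bs[of k l] by (simp add: T_def)
  qed
  moreover have "represents \<theta> B T"
    unfolding represents_def
  proof
    fix u :: "real ^ 'n option"
    have opt: "(\<Sum>i\<in>UNIV. g i) = g None + (\<Sum>i\<in>UNIV. g (Some i))"
      for g :: "'n option \<Rightarrow> real"
      by (simp add: UNIV_option_conv sum.reindex)
    have E: "(\<Sum>i\<in>UNIV. e i * u $ i) = u $ None"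
      by (simp add: opt e_def)
    define Q where "Q = (\<Sum>i\<in>UNIV. \<Sum>j\<in>UNIV. b i j * u $ i * u $ j)"
    have Q: "Q = (\<Sum>i\<in>UNIV. \<Sum>j\<in>UNIV. B $ i $ j * u $ Some i * u $ Some j)"
      by (simp add: Q_def opt b_def)
    have D: "(\<Sum>i\<in>UNIV. \<Sum>j\<in>UNIV. \<Sum>k\<in>UNIV. \<Sum>l\<in>UNIV. d i j k l * u $ i * u $ j * u $ k * u $ l)
      = \<theta> / 2 * (\<Sum>i\<in>UNIV. (u $ Some i) ^ 4)"
    proof -
      have d': "d i j k l * u $ i * u $ j * u $ k * u $ l =
          (if l = i then (if k = i then (if j = i then
             (if i = None then 0 else \<theta> / 2 * (u $ i) ^ 4) else 0) else 0) else 0)"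
        for i j k l
        by (auto simp: d_def power4_eq_xxxx)
      have in2: "(\<Sum>l\<in>UNIV. d i j k l * u $ i * u $ j * u $ k * u $ l) =
          (if k = i then (if j = i then
             (if i = None then 0 else \<theta> / 2 * (u $ i) ^ 4) else 0) else 0)" for i j k
        unfolding d' by (simp only: sum.delta finite UNIV_I if_True)
      have "(\<Sum>j\<in>UNIV. \<Sum>k\<in>UNIV. \<Sum>l\<in>UNIV. d i j k l * u $ i * u $ j * u $ k * u $ l) =
          (if i = None then 0 else \<theta> / 2 * (u $ i) ^ 4)" for i
        unfolding in2 by (simp only: sum.delta finite UNIV_I if_True)
      then show ?thesis
        by (simp add: opt sum_distrib_left)
    qed
    have F: "(\<Sum>i\<in>UNIV. \<Sum>j\<in>UNIV. \<Sum>k\<in>UNIV. \<Sum>l\<in>UNIV.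
        (e i * u $ i) * ((e j * u $ j) * (b k l * u $ k * u $ l))) = (u $ None)\<^sup>2 * Q"
      unfolding Q_def by (simp add: E power2_eq_square flip: sum_distrib_left sum_distrib_right)
    have sw: "(\<Sum>i\<in>UNIV. \<Sum>j\<in>UNIV. g i j) = (\<Sum>j\<in>UNIV. \<Sum>i\<in>UNIV. g i j)"
      for g :: "'n option \<Rightarrow> 'n option \<Rightarrow> real"
      by (rule sum.swap)
    define G where "G = (\<lambda>i j k l. (e i * u $ i) * ((e j * u $ j) * (b k l * u $ k * u $ l)))"
    let ?S = "\<lambda>g :: 'n option \<Rightarrow> 'n option \<Rightarrow> 'n option \<Rightarrow> 'n option \<Rightarrow> real.
       \<Sum>i\<in>UNIV. \<Sum>j\<in>UNIV. \<Sum>k\<in>UNIV. \<Sum>l\<in>UNIV. g i j k l"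
    have s1: "?S g = ?S (\<lambda>i j k l. g j i k l)" for g by (rule sw)
    have s2: "?S g = ?S (\<lambda>i j k l. g i k j l)" for g
      by (rule sum.cong[OF refl], rule sw)
    have s3: "?S g = ?S (\<lambda>i j k l. g i j l k)" for g
      by (rule sum.cong[OF refl], rule sum.cong[OF refl], rule sw)
    have G0: "?S G = (u $ None)\<^sup>2 * Q" unfolding G_def by (rule F)
    have G1: "?S (\<lambda>i j k l. G i k j l) = (u $ None)\<^sup>2 * Q"
      using s2[of G] G0 by simp
    have G2: "?S (\<lambda>i j k l. G i l j k) = (u $ None)\<^sup>2 * Q"
      using s3[of "\<lambda>i j k l. G i k j l"] G1 by simp
    have G3: "?S (\<lambda>i j k l. G j k i l) = (u $ None)\<^sup>2 * Q"
      using s1[of "\<lambda>i j k l. G i k j l"] G1 by simp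
    have G4: "?S (\<lambda>i j k l. G j l i k) = (u $ None)\<^sup>2 * Q"
      using s1[of "\<lambda>i j k l. G i l j k"] G2 by simp
    have G5: "?S (\<lambda>i j k l. G k l i j) = (u $ None)\<^sup>2 * Q"
      using s2[of "\<lambda>i j k l. G j l i k"] G4 by simp
    have "T $ i $ j $ k $ l * u $ i * u $ j * u $ k * u $ l =
        d i j k l * u $ i * u $ j * u $ k * u $ l +
        (G i j k l + G i k j l + G i l j k + G j k i l + G j l i k + G k l i j) / 6" for i j k l
      by (simp add: T_def G_def field_simps)
    then have "tensor_apply T u u u u =
        ?S (\<lambda>i j k l. d i j k l * u $ i * u $ j * u $ k * u $ l) +
        (?S G + ?S (\<lambda>i j k l. G i k j l) + ?S (\<lambda>i j k l. G i l j k) + ?S (\<lambda>i j k l. G j k i l)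
         + ?S (\<lambda>i j k l. G j l i k) + ?S (\<lambda>i j k l. G k l i j)) / 6"
      unfolding tensor_apply_def by (simp add: sum.distrib flip: sum_divide_distrib)
    then show "tensor_apply T u u u u =
        \<theta> / 2 * (\<Sum>i\<in>UNIV. (u $ Some i) ^ 4) +
        (u $ None)\<^sup>2 * (\<Sum>i\<in>UNIV. \<Sum>j\<in>UNIV. B $ i $ j * u $ Some i * u $ Some j)"
      unfolding G0 G1 G2 G3 G4 G5 D Q[symmetric] by simp
  qed
  ultimately show "\<exists>T. symmetric_tensor T \<and> represents \<theta> B T" by blast
next
  fix S T :: "('n option) tensor4"
  assume S: "symmetric_tensor S \<and> represents \<theta> B S" and T: "symmetric_tensor T \<and> represents \<theta> B T"
  have "tensor_apply S u u u u = tensor_apply T u u u u" for u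
    using S T by (simp add: represents_def)
  then have "24 * tensor_apply S p q r s = 24 * tensor_apply T p q r s" for p q r s
    using S T by (simp add: tensor_apply_polarization)
  then have "S $ i $ j $ k $ l = T $ i $ j $ k $ l" for i j k l
    by (metis mult_cancel_left tensor_apply_axis zero_neq_numeral)
  then show "S = T" by (simp add: vec_eq_iff)
qed


section \<open>Objective functions and optimality\<close>

definition f_alpha :: "real \<Rightarrow> real ^ 'n ^ 'n \<Rightarrow> real \<Rightarrow> real ^ 'n::finite \<Rightarrow> real" where
  "f_alpha \<theta> B \<alpha> x =
     tensor_apply (tensor_f \<theta> B) (lift x) (lift x) (lift x) (lift x) - \<alpha> * norm (lift x) ^ 4"

definition F_alpha :: "real \<Rightarrow> real ^ 'n ^ 'n \<Rightarrow> real \<Rightarrow> real ^ ('n::finite option) \<Rightarrow>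
    real ^ ('n option) \<Rightarrow> real ^ ('n option) \<Rightarrow> real ^ ('n option) \<Rightarrow> real" where
  "F_alpha \<theta> B \<alpha> p q r s = tensor_apply (tensor_f \<theta> B) p q r s - \<alpha> * (p \<bullet> q) * (r \<bullet> s)"

definition lifted_sphere :: "(real ^ ('n::finite option)) set" where
  "lifted_sphere = {lift x | x. norm x = 1}"

definition gradient :: "('a::real_inner \<Rightarrow> real) \<Rightarrow> 'a \<Rightarrow> 'a" where
  "gradient f x = (THE D. GDERIV f x :> D)"

definition kkt_point :: "real \<Rightarrow> real ^ 'n ^ 'n \<Rightarrow> real \<Rightarrow> real ^ 'n::finite \<Rightarrow> bool" where
  "kkt_point \<theta> B \<alpha> x \<longleftrightarrow>
     norm x = 1 \<and> (\<exists>\<mu>. gradient (f_alpha \<theta> B \<alpha>) x = (2 * \<mu>) *\<^sub>R x)"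

definition strictly_concave_on :: "'a::real_vector set \<Rightarrow> ('a \<Rightarrow> real) \<Rightarrow> bool" where
  "strictly_concave_on S f \<longleftrightarrow> convex S \<and>
     (\<forall>x\<in>S. \<forall>y\<in>S. \<forall>t. x \<noteq> y \<longrightarrow> 0 < t \<longrightarrow> t < 1 \<longrightarrow>
        (1 - t) * f x + t * f y < f ((1 - t) *\<^sub>R x + t *\<^sub>R y))"

definition cluster_point :: "(nat \<Rightarrow> 'a::topological_space) \<Rightarrow> 'a \<Rightarrow> bool" where
  "cluster_point X c \<longleftrightarrow> (\<exists>r. strict_mono r \<and> (X \<circ> r) \<longlonglongrightarrow> c)"


section \<open>The algorithms\<close>

text \<open>Minimizers need not be unique, so the PAM algorithm is nondeterministic: \<open>pam_step\<close>
  relates consecutive iterates, and \<open>pam_returns\<close> says that some run of the algorithm returns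
  \<open>ustar\<close>. The iterates are given by their parts in \<open>\<real>\<^sup>n\<close>; \<open>lift\<close> is injective.\<close>

definition pam_step :: "real \<Rightarrow> real ^ 'n ^ 'n \<Rightarrow> real \<Rightarrow> real \<Rightarrow> real \<Rightarrow> real \<Rightarrow> real \<Rightarrow>
    real ^ 'n \<Rightarrow> real ^ 'n \<Rightarrow> real ^ 'n \<Rightarrow> real ^ 'n \<Rightarrow>
    real ^ 'n \<Rightarrow> real ^ 'n \<Rightarrow> real ^ 'n \<Rightarrow> real ^ 'n::finite \<Rightarrow> bool" where
  "pam_step \<theta> B \<alpha> \<gamma>1 \<gamma>2 \<gamma>3 \<gamma>4 x y z w x' y' z' w' \<longleftrightarrow>
     is_arg_min (\<lambda>p. F_alpha \<theta> B \<alpha> p (lift y) (lift z) (lift w) + \<gamma>1 / 2 * (dist p (lift x))\<^sup>2)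
       (\<lambda>p. p \<in> lifted_sphere) (lift x') \<and>
     is_arg_min (\<lambda>p. F_alpha \<theta> B \<alpha> (lift x') p (lift z) (lift w) + \<gamma>2 / 2 * (dist p (lift y))\<^sup>2)
       (\<lambda>p. p \<in> lifted_sphere) (lift y') \<and>
     is_arg_min (\<lambda>p. F_alpha \<theta> B \<alpha> (lift x') (lift y') p (lift w) + \<gamma>3 / 2 * (dist p (lift z))\<^sup>2)
       (\<lambda>p. p \<in> lifted_sphere) (lift z') \<and>
     is_arg_min (\<lambda>p. F_alpha \<theta> B \<alpha> (lift x') (lift y') (lift z') p + \<gamma>4 / 2 * (dist p (lift w))\<^sup>2)
       (\<lambda>p. p \<in> lifted_sphere) (lift w')"

text \<open>The run stops in step \<open>K\<close>, the first one that meets the stopping criterion; the values of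
  the sequences beyond index \<open>K + 1\<close> are irrelevant.\<close>

definition pam_returns :: "real \<Rightarrow> real ^ 'n ^ 'n \<Rightarrow> real \<Rightarrow> real \<Rightarrow> real \<Rightarrow> real \<Rightarrow> real \<Rightarrow> real \<Rightarrow>
    real ^ 'n \<Rightarrow> real ^ 'n \<Rightarrow> real ^ 'n \<Rightarrow> real ^ 'n \<Rightarrow> real ^ 'n::finite \<Rightarrow> bool" where
  "pam_returns \<theta> B \<alpha> \<epsilon> \<gamma>1 \<gamma>2 \<gamma>3 \<gamma>4 x0 y0 z0 w0 ustar \<longleftrightarrow>
     (\<exists>x y z w u K.
        x 0 = x0 \<and> y 0 = y0 \<and> z 0 = z0 \<and> w 0 = w0 \<and>
        (\<forall>k\<le>K. pam_step \<theta> B \<alpha> \<gamma>1 \<gamma>2 \<gamma>3 \<gamma>4 (x k) (y k) (z k) (w k)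
                 (x (Suc k)) (y (Suc k)) (z (Suc k)) (w (Suc k))) \<and>
        (\<forall>k\<le>Suc K. is_arg_min (f_alpha \<theta> B \<alpha>) (\<lambda>v. v \<in> {x k, y k, z k, w k}) (u k)) \<and>
        (\<forall>k<K. \<bar>f_alpha \<theta> B \<alpha> (u (Suc k)) - f_alpha \<theta> B \<alpha> (u k)\<bar> > \<epsilon>) \<and>
        \<bar>f_alpha \<theta> B \<alpha> (u (Suc K)) - f_alpha \<theta> B \<alpha> (u K)\<bar> \<le> \<epsilon> \<and>
        ustar = u (Suc K))"

text \<open>The iteration is never stopped: it stays constant once it hits a fixed point, so its
  objective values can decrease strictly only until then.\<close>

definition enhanced_bim :: "real \<Rightarrow> real ^ 'n ^ 'n \<Rightarrow> real \<Rightarrow> real ^ 'n \<Rightarrow>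
    (nat \<Rightarrow> real ^ 'n::finite) \<Rightarrow> bool" where
  "enhanced_bim \<theta> B \<alpha> ustar x \<longleftrightarrow>
     x 0 = ustar \<and>
     (\<forall>k. x (Suc k) =
        (let g = gradient (f_alpha \<theta> B \<alpha>) (x k) in if g = 0 then x k else - (g /\<^sub>R norm g)))"

end

(* Along the unit sphere the objective agrees up to a constant with a quartic whose Taylor
   remainder is explicit. Since the new iterate y is opposite to the gradient at x, this gives
     f(x) - f(y) >= (8 alpha - 4 theta - 2 |B|) |y - x|^2.
   The entries of the tensor are known by polarization, so that
   |T|^2 >= n theta^2 / 4 + |B|^2 / 6, which makes the constant positive for n >= 2. Thus the
   steps tend to 0, and a cluster point is a fixed point of the iteration,
   so the gradient there is parallel to it. *)

theory Submission
  imports Defs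
begin

section \<open>Sums over the extended index type and quadratic forms\<close>

lemma sum_option:
  "(\<Sum>i\<in>UNIV. g i) = g None + (\<Sum>i\<in>UNIV. g (Some i))"
  for g :: "'n::finite option \<Rightarrow> real"
  by (simp add: UNIV_option_conv sum.reindex)

lemma inner_matrix_vector:
  fixes B :: "real ^ 'n::finite ^ 'n"
  shows "x \<bullet> (B *v y) = (\<Sum>i\<in>UNIV. \<Sum>j\<in>UNIV. B $ i $ j * x $ i * y $ j)"
  by (simp add: inner_vec_def matrix_vector_mult_def sum_distrib_left mult_ac)

text \<open>Cauchy-Schwarz in each row: \<open>norm B\<close> is the Frobenius norm, which dominates
  the operator norm.\<close>

lemma norm_matrix_vector_le:
  fixes B :: "real ^ 'n::finite ^ 'm::finite"
  shows "norm (B *v x) \<le> norm B * norm x"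
proof -
  have "norm (B *v x) \<le> L2_set (\<lambda>i. norm (B $ i) * norm x) UNIV"
    unfolding norm_vec_def[of "B *v x"]
    by (rule L2_set_mono) (auto simp: matrix_vector_mul_component Cauchy_Schwarz_ineq2)
  also have "\<dots> = norm B * norm x"
    by (simp add: norm_vec_def[of B] L2_set_left_distrib)
  finally show ?thesis .
qed

lemma abs_quadratic_form_le:
  fixes B :: "real ^ 'n::finite ^ 'n"
  shows "\<bar>x \<bullet> (B *v x)\<bar> \<le> norm B * (norm x)\<^sup>2"
proof -
  have "\<bar>x \<bullet> (B *v x)\<bar> \<le> norm x * norm (B *v x)"
    by (rule Cauchy_Schwarz_ineq2)
  also have "\<dots> \<le> norm x * (norm B * norm x)"
    by (intro mult_left_mono norm_matrix_vector_le) auto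
  finally show ?thesis by (simp add: power2_eq_square mult_ac)
qed

lemma inner_matrix_vector_commute:
  fixes B :: "real ^ 'n::finite ^ 'n"
  assumes "transpose B = B"
  shows "x \<bullet> (B *v y) = y \<bullet> (B *v x)"
  using dot_lmul_matrix[of x B y] assms
  by (metis inner_commute transpose_matrix_vector)

section \<open>The norm of the tensor\<close>

lemma tensor_f:
  assumes "transpose B = B"
  shows "symmetric_tensor (tensor_f \<theta> B)" "represents \<theta> B (tensor_f \<theta> B)"
  using theI'[OF tensor_f_ex1[OF assms, of \<theta>]] unfolding tensor_f_def by auto

lemma tensor_f_diagonal:
  fixes B :: "real ^ 'n::finite ^ 'n"
  assumes "transpose B = B"
  shows "tensor_f \<theta> B $ Some i $ Some i $ Some i $ Some i = \<theta> / 2"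
proof -
  have "tensor_f \<theta> B $ Some i $ Some i $ Some i $ Some i =
      tensor_apply (tensor_f \<theta> B) (axis (Some i) 1) (axis (Some i) 1) (axis (Some i) 1) (axis (Some i) 1)"
    by (simp add: tensor_apply_axis)
  also have "\<dots> = \<theta> / 2"
    using tensor_f(2)[OF assms, of \<theta>]
    by (simp add: represents_def axis_def if_distrib[of "\<lambda>t. t ^ _"] cong: if_cong)
  finally show ?thesis .
qed

text \<open>For i \<noteq> j the coefficient 2 b_ij of u_0^2 u_i u_j is shared by 12 equal entries,
  for i = j the coefficient b_ii by 6; either way each entry gets one sixth of b_ij. Polarization
  treats both cases at once.\<close>

lemma tensor_f_mixed:
  fixes B :: "real ^ 'n::finite ^ 'n"
  assumes "transpose B = B"
  shows "tensor_f \<theta> B $ None $ None $ Some i $ Some j = B $ i $ j / 6"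
proof -
  define T where "T = tensor_f \<theta> B"
  \<comment> \<open>\<open>v c x\<close> has zeroth coordinate \<open>c\<close> and remaining part
    \<open>x\<close>. The family is closed under addition and contains all axis vectors, so
    \<open>rep\<close> evaluates every term of the polarization formula.\<close>
  define v where "v = (\<lambda>(c::real) (x::real^'n). (\<chi> i. case i of None \<Rightarrow> c | Some k \<Rightarrow> x $ k))"
  define N where "N = (\<lambda>x::real^'n. \<theta> / 2 * (\<Sum>i\<in>UNIV. (x $ i) ^ 4))"
  define Q where "Q = (\<lambda>x::real^'n. x \<bullet> (B *v x))"
  have rep: "tensor_apply T (v c x) (v c x) (v c x) (v c x) = N x + c\<^sup>2 * Q x" for c x
    using tensor_f(2)[OF assms, of \<theta>]
    by (simp add: represents_def T_def v_def N_def Q_def inner_matrix_vector)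
  have add: "v c x + v c' x' = v (c + c') (x + x')" for c c' x x'
    by (auto simp: v_def vec_eq_iff split: option.splits)
  have ax: "axis None 1 = v 1 0" "axis (Some k) 1 = v 0 (axis k 1)" for k
    by (auto simp: v_def axis_def vec_eq_iff split: option.splits)
  have Qadd: "Q (x + y) = Q x + Q y + 2 * (x \<bullet> (B *v y))" for x y
    using inner_matrix_vector_commute[OF assms, of x y]
    by (simp add: Q_def inner_add_left inner_add_right matrix_vector_right_distrib)
  have Q0: "Q 0 = 0" "N 0 = 0" by (simp_all add: Q_def N_def)
  \<comment> \<open>The quartic terms \<open>N\<close> cancel in the alternating sum, and the
    \<open>Q\<close> terms add up to \<open>2 * (Q (x + y) - Q x - Q y)\<close>.\<close>
  have "24 * tensor_apply T (v 1 0) (v 1 0) (v 0 x) (v 0 y) = 4 * (x \<bullet> (B *v y))" for x y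
    unfolding tensor_apply_polarization[OF tensor_f(1)[OF assms, of \<theta>, folded T_def]] add rep
    by (simp add: Qadd Q0 algebra_simps)
  from this[of "axis i 1" "axis j 1"]
  have "24 * T $ None $ None $ Some i $ Some j = 4 * B $ i $ j"
    unfolding ax[symmetric] tensor_apply_axis
    by (simp add: inner_axis' matrix_vector_mult_basis column_def)
  then show ?thesis by (simp add: T_def)
qed

text \<open>Only two kinds of entries are counted: the n diagonal ones, equal to \<theta>/2, and
  those with exactly two indices \<open>None\<close>. The latter have six possible placements, each
  contributing \<open>(norm B)\<^sup>2 / 36\<close>.\<close>

lemma norm_tensor_f_ge:
  fixes B :: "real ^ 'n::finite ^ 'n"
  assumes "transpose B = B"
  shows "real CARD('n) * \<theta>\<^sup>2 / 4 + (norm B)\<^sup>2 / 6 \<le> (norm (tensor_f \<theta> B))\<^sup>2"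
proof -
  define T where "T = tensor_f \<theta> B"
  define q where "q = (\<lambda>i j k l. (T $ i $ j $ k $ l)\<^sup>2)"
  have sym: "T $ i $ j $ k $ l = T $ j $ i $ k $ l" "T $ i $ j $ k $ l = T $ i $ k $ j $ l"
    "T $ i $ j $ k $ l = T $ i $ j $ l $ k" for i j k l
    using tensor_f(1)[OF assms, of \<theta>] unfolding symmetric_tensor_def T_def by blast+
  have q0: "q i j k l \<ge> 0" for i j k l by (simp add: q_def)
  have entry: "T $ None $ None $ Some i $ Some j = B $ i $ j / 6" for i j
    using tensor_f_mixed[OF assms] by (simp add: T_def)
  have sixsq: "6\<^sup>2 = (36::real)" by simp
  have mixed: "q None None (Some i) (Some j) = (B $ i $ j)\<^sup>2 / 36"
      "q None (Some i) None (Some j) = (B $ i $ j)\<^sup>2 / 36"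
      "q None (Some i) (Some j) None = (B $ i $ j)\<^sup>2 / 36"
      "q (Some i) None None (Some j) = (B $ i $ j)\<^sup>2 / 36"
      "q (Some i) None (Some j) None = (B $ i $ j)\<^sup>2 / 36"
      "q (Some i) (Some j) None None = (B $ i $ j)\<^sup>2 / 36" for i j
    unfolding q_def using entry[of i j] sym by (metis power_divide sixsq)+
  have diag: "real CARD('n) * \<theta>\<^sup>2 / 4 \<le> (\<Sum>i\<in>UNIV. \<Sum>j\<in>UNIV. \<Sum>k\<in>UNIV. \<Sum>l\<in>UNIV.
      q (Some i) (Some j) (Some k) (Some l))"
  proof -
    have "\<theta>\<^sup>2 / 4 \<le> (\<Sum>j\<in>UNIV. \<Sum>k\<in>UNIV. \<Sum>l\<in>UNIV. q (Some i) (Some j) (Some k) (Some l))" for i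
    proof -
      have "\<theta>\<^sup>2 / 4 = q (Some i) (Some i) (Some i) (Some i)"
        unfolding q_def T_def tensor_f_diagonal[OF assms] by (simp add: power_divide)
      also have "\<dots> \<le> (\<Sum>l\<in>UNIV. q (Some i) (Some i) (Some i) (Some l))"
        by (rule member_le_sum) (auto simp: q0)
      also have "\<dots> \<le> (\<Sum>k\<in>UNIV. \<Sum>l\<in>UNIV. q (Some i) (Some i) (Some k) (Some l))"
        by (rule member_le_sum[where f="\<lambda>k. \<Sum>l\<in>UNIV. q (Some i) (Some i) (Some k) (Some l)"])
          (auto simp: q0 sum_nonneg)
      also have "\<dots> \<le> (\<Sum>j\<in>UNIV. \<Sum>k\<in>UNIV. \<Sum>l\<in>UNIV. q (Some i) (Some j) (Some k) (Some l))"
        by (rule member_le_sum[where f="\<lambda>j. \<Sum>k\<in>UNIV. \<Sum>l\<in>UNIV. q (Some i) (Some j) (Some k) (Some l)"])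
          (auto simp: q0 sum_nonneg)
      finally show ?thesis .
    qed
    from sum_mono[OF this, of UNIV] show ?thesis by simp
  qed
  have normB: "(norm B)\<^sup>2 = (\<Sum>i\<in>UNIV. \<Sum>j\<in>UNIV. (B $ i $ j)\<^sup>2)"
    by (simp add: norm_vec_def L2_set_def sum_nonneg)
  have nn: "(\<Sum>i\<in>UNIV. g i) \<ge> 0" if "\<And>i. g i \<ge> 0" for g :: "'n \<Rightarrow> real"
    using that by (simp add: sum_nonneg)
  have "(norm T)\<^sup>2 = (\<Sum>i\<in>UNIV. \<Sum>j\<in>UNIV. \<Sum>k\<in>UNIV. \<Sum>l\<in>UNIV. q i j k l)"
    unfolding norm_tensor4 q_def by (simp add: sum_nonneg)
  \<comment> \<open>Splitting off \<open>None\<close> in all four sums gives 16 blocks: the six in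
    \<open>mixed\<close> and the one without \<open>None\<close> are kept, the other nine are
    nonnegative.\<close>
  also have "\<dots> \<ge> (\<Sum>i\<in>UNIV. \<Sum>j\<in>UNIV. \<Sum>k\<in>UNIV. \<Sum>l\<in>UNIV. q (Some i) (Some j) (Some k) (Some l))
      + 6 * (\<Sum>i\<in>UNIV. \<Sum>j\<in>UNIV. (B $ i $ j)\<^sup>2 / 36)"
    unfolding sum_option sum.distrib mixed
    by (simp add: nn q0)
  finally show ?thesis
    using diag by (simp add: T_def normB flip: sum_divide_distrib)
qed

text \<open>Makes the descent constant positive as soon as \<alpha> is at least the tensor norm.
  After squaring, the lower bound on that norm leaves a sum of squares; n \<ge> 2 supplies the term
  \<open>\<theta>\<^sup>2 / 2\<close>.\<close>

lemma norm_tensor_f_gt: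
  fixes B :: "real ^ 'n::finite ^ 'n"
  assumes "transpose B = B" "CARD('n) \<ge> 2" "\<theta> > 0"
  shows "4 * \<theta> + 2 * norm B < 8 * norm (tensor_f \<theta> B)"
proof -
  have "2 * \<theta>\<^sup>2 \<le> real CARD('n) * \<theta>\<^sup>2"
    using assms(2) by (intro mult_right_mono) auto
  with norm_tensor_f_ge[OF assms(1), of \<theta>]
  have *: "\<theta>\<^sup>2 / 2 + (norm B)\<^sup>2 / 6 \<le> (norm (tensor_f \<theta> B))\<^sup>2" by simp
  have "64 * (\<theta>\<^sup>2 / 2 + (norm B)\<^sup>2 / 6) - (4 * \<theta> + 2 * norm B)\<^sup>2 =
      4 * (2 * \<theta> - norm B)\<^sup>2 + 8 / 3 * (norm B)\<^sup>2"
    by (simp add: power2_eq_square algebra_simps)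
  \<comment> \<open>The two squares cannot vanish together, since \<open>norm B = 0\<close> leaves a
    multiple of \<open>\<theta>\<^sup>2\<close>.\<close>
  moreover have "0 < 4 * (2 * \<theta> - norm B)\<^sup>2 + 8 / 3 * (norm B)\<^sup>2"
    using assms(3) by (cases "norm B = 0") (auto simp: add_nonneg_pos)
  ultimately have "(4 * \<theta> + 2 * norm B)\<^sup>2 < 64 * (\<theta>\<^sup>2 / 2 + (norm B)\<^sup>2 / 6)"
    by linarith
  also have "\<dots> \<le> (8 * norm (tensor_f \<theta> B))\<^sup>2"
    using * by (simp add: power_mult_distrib)
  finally show ?thesis by (rule power2_less_imp_less) simp
qed

section \<open>The objective function\<close>

lemma norm_lift: "norm (lift x) ^ 4 = (1 + x \<bullet> x)\<^sup>2"
proof -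
  have "(norm (lift x))\<^sup>2 = 1 + x \<bullet> x"
    by (simp add: power2_norm_eq_inner inner_vec_def sum_option lift_def)
  then have "((norm (lift x))\<^sup>2)\<^sup>2 = (1 + x \<bullet> x)\<^sup>2" by simp
  then show ?thesis by simp
qed

lemma f_alpha_eq:
  fixes B :: "real ^ 'n::finite ^ 'n"
  assumes "transpose B = B"
  shows "f_alpha \<theta> B \<alpha> x =
    \<theta> / 2 * (\<Sum>i\<in>UNIV. (x $ i) ^ 4) + x \<bullet> (B *v x) - \<alpha> * (1 + x \<bullet> x)\<^sup>2"
  using tensor_f(2)[OF assms, of \<theta>]
  unfolding f_alpha_def norm_lift represents_def by (simp add: lift_def inner_matrix_vector)

section \<open>The gradient in closed form\<close>

lemma gradient_eqI:
  assumes "GDERIV f x :> D"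
  shows "gradient f x = D"
  unfolding gradient_def
proof (rule the_equality)
  fix D' assume "GDERIV f x :> D'"
  then have "(\<lambda>h. h \<bullet> D') = (\<lambda>h. h \<bullet> D)"
    using assms has_derivative_unique unfolding gderiv_def by blast
  then show "D' = D"
    by (metis vector_eq_ldot)
qed (rule assms)

text \<open>For symmetric \<open>B\<close> this is the gradient of \<open>f_alpha\<close>.\<close>

definition grad_f :: "real \<Rightarrow> real ^ 'n ^ 'n \<Rightarrow> real \<Rightarrow> real ^ 'n::finite \<Rightarrow> real ^ 'n" where
  "grad_f \<theta> B \<alpha> x =
     (2 * \<theta>) *\<^sub>R (\<chi> i. (x $ i) ^ 3) + 2 *\<^sub>R (B *v x) - (4 * \<alpha> * (1 + x \<bullet> x)) *\<^sub>R x"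

lemma gradient_f_alpha:
  fixes B :: "real ^ 'n::finite ^ 'n"
  assumes "transpose B = B"
  shows "gradient (f_alpha \<theta> B \<alpha>) x = grad_f \<theta> B \<alpha> x"
proof (rule gradient_eqI)
  have eq: "f_alpha \<theta> B \<alpha> = (\<lambda>x. \<theta> / 2 * (\<Sum>i\<in>UNIV. (x $ i) ^ 4) + x \<bullet> (B *v x) - \<alpha> * (1 + x \<bullet> x)\<^sup>2)"
    by (rule ext) (rule f_alpha_eq[OF assms])
  have nth: "((\<lambda>x. x $ i) has_derivative (\<lambda>h. h $ i)) (at x)" for i and x :: "real ^ 'n"
    by (rule bounded_linear.has_derivative[OF bounded_linear_vec_nth has_derivative_ident])
  have B: "((\<lambda>x. B *v x) has_derivative (\<lambda>h. B *v h)) (at x)"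
    by (rule bounded_linear.has_derivative[OF matrix_vector_mul_bounded_linear has_derivative_ident])
  show "GDERIV (f_alpha \<theta> B \<alpha>) x :> grad_f \<theta> B \<alpha> x"
    unfolding gderiv_def eq
  proof (rule has_derivative_eq_rhs)
    show "((\<lambda>x. \<theta> / 2 * (\<Sum>i\<in>UNIV. (x $ i) ^ 4) + x \<bullet> (B *v x) - \<alpha> * (1 + x \<bullet> x)\<^sup>2) has_derivative
      (\<lambda>h. \<theta> / 2 * (\<Sum>i\<in>UNIV. 4 * h $ i * (x $ i) ^ 3) + (x \<bullet> (B *v h) + h \<bullet> (B *v x))
         - \<alpha> * (2 * (x \<bullet> h + h \<bullet> x) * (1 + x \<bullet> x)))) (at x)"
      by (auto intro!: derivative_eq_intros nth B)
  next
    show "(\<lambda>h. \<theta> / 2 * (\<Sum>i\<in>UNIV. 4 * h $ i * (x $ i) ^ 3) + (x \<bullet> (B *v h) + h \<bullet> (B *v x))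
         - \<alpha> * (2 * (x \<bullet> h + h \<bullet> x) * (1 + x \<bullet> x))) = (\<lambda>h. h \<bullet> grad_f \<theta> B \<alpha> x)"
    proof
      fix h
      have "(\<Sum>i\<in>UNIV. 4 * h $ i * (x $ i) ^ 3) = 4 * (h \<bullet> (\<chi> i. (x $ i) ^ 3))"
        by (simp add: inner_vec_def sum_distrib_left mult_ac)
      then show "\<theta> / 2 * (\<Sum>i\<in>UNIV. 4 * h $ i * (x $ i) ^ 3) + (x \<bullet> (B *v h) + h \<bullet> (B *v x))
         - \<alpha> * (2 * (x \<bullet> h + h \<bullet> x) * (1 + x \<bullet> x)) = h \<bullet> grad_f \<theta> B \<alpha> x"
        using inner_matrix_vector_commute[OF assms, of x h]
        by (simp add: grad_f_def inner_diff_right inner_add_right inner_commute[of h x] algebra_simps)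
    qed
  qed
qed

section \<open>Descent in one iteration step\<close>

lemma sum_power4_le_1:
  fixes x :: "real ^ 'n::finite"
  assumes "norm x = 1"
  shows "(\<Sum>i\<in>UNIV. (x $ i) ^ 4) \<le> 1"
proof -
  have "(x $ i) ^ 4 \<le> (x $ i)\<^sup>2" for i
    using component_le_norm_cart[of x i] assms power_decreasing[of 2 4 "\<bar>x $ i\<bar>"] by simp
  then have "(\<Sum>i\<in>UNIV. (x $ i) ^ 4) \<le> (\<Sum>i\<in>UNIV. (x $ i)\<^sup>2)" by (rule sum_mono)
  also have "\<dots> = x \<bullet> x" by (simp add: inner_vec_def power2_eq_square)
  finally show ?thesis using assms by (simp add: dot_square_norm)
qed

text \<open>On the unit sphere \<open>f\<^sub>\<alpha>\<close> and its gradient agree, up to a constant, with those of the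
  quartic in which \<open>\<alpha>\<parallel>(1, x)\<parallel>\<^sup>4\<close> is replaced by \<open>4\<alpha>\<parallel>x\<parallel>\<^sup>2\<close>; the bound
  comes from the exact Taylor expansion of that quartic at \<open>x\<close>.\<close>

lemma f_alpha_taylor:
  fixes B :: "real ^ 'n::finite ^ 'n"
  assumes "transpose B = B" "norm x = 1" "norm y = 1" "\<theta> > 0"
  shows "f_alpha \<theta> B \<alpha> y \<le> f_alpha \<theta> B \<alpha> x + grad_f \<theta> B \<alpha> x \<bullet> (y - x)
    + (norm B + 3 * \<theta> - 4 * \<alpha>) * (norm (y - x))\<^sup>2"
proof -
  define d where "d = y - x"
  have y: "y = x + d" by (simp add: d_def)
  have x1: "x \<bullet> x = 1" and y1: "y \<bullet> y = 1" using assms by (auto simp: dot_square_norm)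
  \<comment> \<open>Both points have length 1. This turns the \<alpha> part of the linear term,
    \<open>- 8 * \<alpha> * (x \<bullet> d)\<close>, into a multiple of the squared step
    length.\<close>
  have dd: "d \<bullet> d = - 2 * (x \<bullet> d)"
    using y1 x1 by (simp add: y inner_add_left inner_add_right inner_commute)
  have Q: "y \<bullet> (B *v y) = x \<bullet> (B *v x) + 2 * (d \<bullet> (B *v x)) + d \<bullet> (B *v d)"
    using inner_matrix_vector_commute[OF assms(1), of x d]
    by (simp add: y inner_add_left inner_add_right matrix_vector_right_distrib)
  \<comment> \<open>The exact remainder after the linear term is \<open>d\<^sup>2\<close> times 3x^2
    + 2xy + y^2. As 2xy \<le> x^2 + y^2 and both coordinates lie in [-1, 1], that factor is at most
    6; multiplied by \<theta>/2 it yields the 3 \<theta> of the bound.\<close>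
  have "(y $ i) ^ 4 \<le> (x $ i) ^ 4 + 4 * ((x $ i) ^ 3 * d $ i) + 6 * (d $ i * d $ i)" for i
  proof -
    have "\<bar>x $ i\<bar> \<le> 1" "\<bar>y $ i\<bar> \<le> 1"
      using component_le_norm_cart[of x i] component_le_norm_cart[of y i] assms by auto
    then have "(x $ i)\<^sup>2 \<le> 1" "(y $ i)\<^sup>2 \<le> 1"
      by (simp_all add: abs_square_le_1)
    moreover have "0 \<le> (x $ i - y $ i)\<^sup>2" by simp
    ultimately have "3 * (x $ i)\<^sup>2 + 2 * x $ i * y $ i + (y $ i)\<^sup>2 \<le> 6"
      by (simp add: power2_eq_square algebra_simps)
    then have "(d $ i)\<^sup>2 * (3 * (x $ i)\<^sup>2 + 2 * x $ i * y $ i + (y $ i)\<^sup>2) \<le> (d $ i)\<^sup>2 * 6"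
      by (rule mult_left_mono) simp
    moreover have "(y $ i) ^ 4 = (x $ i) ^ 4 + 4 * ((x $ i) ^ 3 * d $ i)
        + (d $ i)\<^sup>2 * (3 * (x $ i)\<^sup>2 + 2 * x $ i * y $ i + (y $ i)\<^sup>2)"
      by (simp add: y) algebra
    ultimately show ?thesis by (simp add: power2_eq_square)
  qed
  then have "(\<Sum>i\<in>UNIV. (y $ i) ^ 4) \<le>
      (\<Sum>i\<in>UNIV. (x $ i) ^ 4 + 4 * ((x $ i) ^ 3 * d $ i) + 6 * (d $ i * d $ i))"
    by (rule sum_mono)
  also have "\<dots> = (\<Sum>i\<in>UNIV. (x $ i) ^ 4) + 4 * ((\<chi> i. (x $ i) ^ 3) \<bullet> d) + 6 * (d \<bullet> d)"
    by (simp add: sum.distrib inner_vec_def sum_distrib_left)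
  finally have "\<theta> / 2 * (\<Sum>i\<in>UNIV. (y $ i) ^ 4) \<le> \<theta> / 2 *
     ((\<Sum>i\<in>UNIV. (x $ i) ^ 4) + 4 * ((\<chi> i. (x $ i) ^ 3) \<bullet> d) + 6 * (d \<bullet> d))"
    using assms(4) by (intro mult_left_mono) auto
  moreover have "d \<bullet> (B *v d) \<le> norm B * (d \<bullet> d)"
    using abs_quadratic_form_le[of d B] by (simp add: power2_norm_eq_inner)
  moreover have "grad_f \<theta> B \<alpha> x \<bullet> d =
      2 * \<theta> * ((\<chi> i. (x $ i) ^ 3) \<bullet> d) + 2 * (d \<bullet> (B *v x)) + 4 * \<alpha> * (d \<bullet> d)"
    by (simp add: grad_f_def inner_diff_left inner_add_left x1 dd inner_commute[of d "B *v x"])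
  ultimately show ?thesis
    unfolding f_alpha_eq[OF assms(1)] d_def[symmetric] power2_norm_eq_inner Q x1 y1
    by (simp add: algebra_simps)
qed

text \<open>For large \<alpha> the right-hand side is negative, so the gradient cannot vanish on the
  sphere; by Cauchy-Schwarz the bound also gives a lower bound on its norm. The 8 \<alpha> arises
  because \<open>1 + x \<bullet> x\<close> equals 2.\<close>

lemma inner_grad_f_le:
  fixes B :: "real ^ 'n::finite ^ 'n"
  assumes "norm x = 1" "\<theta> > 0"
  shows "grad_f \<theta> B \<alpha> x \<bullet> x \<le> 2 * \<theta> + 2 * norm B - 8 * \<alpha>"
proof -
  have x1: "x \<bullet> x = 1" using assms by (auto simp: dot_square_norm)
  have "(\<chi> i. (x $ i) ^ 3) \<bullet> x = (\<Sum>i\<in>UNIV. (x $ i) ^ 4)"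
    by (simp add: inner_vec_def numeral_eq_Suc mult_ac)
  moreover have "\<theta> * (\<Sum>i\<in>UNIV. (x $ i) ^ 4) \<le> \<theta> * 1"
    using sum_power4_le_1[OF assms(1)] assms(2) by (intro mult_left_mono) auto
  moreover have "x \<bullet> (B *v x) \<le> norm B"
    using abs_quadratic_form_le[of x B] assms(1) by simp
  ultimately show ?thesis
    by (simp add: grad_f_def inner_diff_left inner_add_left x1 inner_commute[of "B *v x" x])
qed

text \<open>As \<open>y\<close> points against \<open>g\<close>, the linear Taylor term is -|g|/2
  times the squared step, and |g| \<ge> 8 \<alpha> - 2 \<theta> - 2 |B|. Half of this bound minus
  the Taylor coefficient |B| + 3 \<theta> - 4 \<alpha> is the stated constant.\<close>

lemma bim_descent:
  fixes B :: "real ^ 'n::finite ^ 'n" and \<alpha> :: real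
  assumes "transpose B = B" "norm x = 1" "\<theta> > 0"
  defines "g \<equiv> grad_f \<theta> B \<alpha> x"
  assumes "g \<noteq> 0" and y: "y = - (g /\<^sub>R norm g)"
  shows "(8 * \<alpha> - 4 * \<theta> - 2 * norm B) * (norm (y - x))\<^sup>2 \<le> f_alpha \<theta> B \<alpha> x - f_alpha \<theta> B \<alpha> y"
proof -
  have y1: "norm y = 1" using \<open>g \<noteq> 0\<close> by (simp add: y)
  have g: "g = - (norm g *\<^sub>R y)" using \<open>g \<noteq> 0\<close> by (simp add: y)
  have d: "(norm (y - x))\<^sup>2 = 2 - 2 * (y \<bullet> x)"
    using y1 assms(2) dot_norm_neg[of y x] by (simp add: algebra_simps)
  have gd: "g \<bullet> (y - x) = - norm g / 2 * (norm (y - x))\<^sup>2"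
    using y1 unfolding d by (subst g) (simp add: inner_diff_right dot_square_norm algebra_simps)
  have "- (g \<bullet> x) \<le> norm g"
    using Cauchy_Schwarz_ineq2[of g x] assms(2) by simp
  then have "8 * \<alpha> - 2 * \<theta> - 2 * norm B \<le> norm g"
    using inner_grad_f_le[OF assms(2,3), of B \<alpha>] by (simp add: g_def)
  then have "(8 * \<alpha> - 2 * \<theta> - 2 * norm B) * (norm (y - x))\<^sup>2 \<le> norm g * (norm (y - x))\<^sup>2"
    by (rule mult_right_mono) simp
  with f_alpha_taylor[OF assms(1,2) y1 assms(3), of \<alpha>, folded g_def] gd
  show ?thesis by (simp add: algebra_simps)
qed

text \<open>The lower bound that lets the decreasing objective values converge.\<close>

lemma f_alpha_ge:
  fixes B :: "real ^ 'n::finite ^ 'n"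
  assumes "transpose B = B" "norm x = 1" "\<theta> > 0"
  shows "- norm B - 4 * \<alpha> \<le> f_alpha \<theta> B \<alpha> x"
proof -
  have "x \<bullet> x = 1" using assms by (auto simp: dot_square_norm)
  moreover have "- norm B \<le> x \<bullet> (B *v x)"
    using abs_quadratic_form_le[of x B] assms(2) by simp
  moreover have "0 \<le> \<theta> / 2 * (\<Sum>i\<in>UNIV. (x $ i) ^ 4)"
    using assms(3) by (intro mult_nonneg_nonneg sum_nonneg) auto
  ultimately show ?thesis
    unfolding f_alpha_eq[OF assms(1)] by simp
qed

lemma continuous_grad_f: "continuous_on UNIV (grad_f \<theta> B \<alpha>)"
proof -
  have "continuous_on UNIV (\<lambda>x. B *v x)"
    by (rule linear_continuous_on) simp
  then show ?thesis
    unfolding grad_f_def[abs_def] by (intro continuous_intros)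
qed

section \<open>Convergence\<close>

lemma lifted_sphereD: "lift x \<in> lifted_sphere \<Longrightarrow> norm x = 1"
proof -
  assume "lift x \<in> lifted_sphere"
  then obtain y where y: "lift x = lift y" "norm y = 1" by (auto simp: lifted_sphere_def)
  have "x $ i = y $ i" for i
    using arg_cong[OF y(1), of "\<lambda>v. v $ Some i"] by (simp add: lift_def)
  then have "x = y" by (simp add: vec_eq_iff)
  with y show ?thesis by simp
qed

text \<open>The returned vector is one of the four blocks updated in step \<open>K\<close>, and each
  of these minimizes over \<open>lifted_sphere\<close>.\<close>

lemma pam_returns_norm:
  assumes "pam_returns \<theta> B \<alpha> \<epsilon> \<gamma>1 \<gamma>2 \<gamma>3 \<gamma>4 x0 y0 z0 w0 ustar"
  shows "norm ustar = 1"
proof -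
  from assms obtain x y z w u K where
    "pam_step \<theta> B \<alpha> \<gamma>1 \<gamma>2 \<gamma>3 \<gamma>4 (x K) (y K) (z K) (w K) (x (Suc K)) (y (Suc K)) (z (Suc K)) (w (Suc K))"
    "is_arg_min (f_alpha \<theta> B \<alpha>) (\<lambda>v. v \<in> {x (Suc K), y (Suc K), z (Suc K), w (Suc K)}) (u (Suc K))"
    "ustar = u (Suc K)"
    unfolding pam_returns_def by blast
  then show ?thesis
    by (auto simp: pam_step_def is_arg_min_def dest!: lifted_sphereD)
qed

theorem theorem6:
  fixes \<theta> \<alpha> \<epsilon> \<gamma>1 \<gamma>2 \<gamma>3 \<gamma>4 :: real
    and B :: "real ^ 'n::finite ^ 'n"
    and x0 y0 z0 w0 ustar :: "real ^ 'n"
    and x :: "nat \<Rightarrow> real ^ 'n"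
  assumes "CARD('n) \<ge> 2"
    and "\<theta> > 0"
    and "transpose B = B"
    and "\<forall>i. B $ i $ i > 0"
    and "\<forall>i j. i \<noteq> j \<longrightarrow> B $ i $ j \<le> 0"
    and "\<epsilon> > 0" and "\<gamma>1 \<ge> 0" and "\<gamma>2 \<ge> 0" and "\<gamma>3 \<ge> 0" and "\<gamma>4 \<ge> 0"
    and "norm x0 = 1" and "norm y0 = 1" and "norm z0 = 1" and "norm w0 = 1"
    and "pam_returns \<theta> B \<alpha> \<epsilon> \<gamma>1 \<gamma>2 \<gamma>3 \<gamma>4 x0 y0 z0 w0 ustar"
    and "enhanced_bim \<theta> B \<alpha> ustar x"
    and "\<alpha> \<ge> norm (tensor_f \<theta> B)"
  shows "(\<forall>k. x (Suc k) \<noteq> x k \<longrightarrow> f_alpha \<theta> B \<alpha> (x (Suc k)) < f_alpha \<theta> B \<alpha> (x k)) \<and>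
    (\<forall>c. cluster_point x c \<longrightarrow> kkt_point \<theta> B \<alpha> c) \<and>
    (strictly_concave_on UNIV (f_alpha \<theta> B \<alpha>) \<longrightarrow>
       (\<lambda>k. norm (x (Suc k) - x k)) \<longlonglongrightarrow> 0)"
proof -
  define f where "f = f_alpha \<theta> B \<alpha>"
  define G where "G = grad_f \<theta> B \<alpha>"
  define c where "c = 8 * \<alpha> - 4 * \<theta> - 2 * norm B"
  note sym = assms(3)
  have c: "c > 0"
    using norm_tensor_f_gt[OF sym assms(1,2)] assms(17) by (simp add: c_def)
  \<comment> \<open>The inner product of \<open>G v\<close> with \<open>v\<close> is at most
    \<open>- c - 2 * \<theta>\<close>, hence negative. The constant branch of the iteration is
    therefore never taken.\<close>
  have G_ne: "G v \<noteq> 0" if "norm v = 1" for v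
    using inner_grad_f_le[OF that assms(2), of B \<alpha>] c assms(2) by (auto simp: G_def c_def)
  have x_0: "x 0 = ustar" using assms(16) by (simp add: enhanced_bim_def)
  have x_Suc: "x (Suc k) = (if G (x k) = 0 then x k else - (G (x k) /\<^sub>R norm (G (x k))))" for k
    using assms(16) by (simp add: enhanced_bim_def Let_def gradient_f_alpha[OF sym] G_def)
  have norm_x: "norm (x k) = 1" for k
    by (induction k) (auto simp: x_0 x_Suc pam_returns_norm[OF assms(15)])
  have step: "x (Suc k) = - (G (x k) /\<^sub>R norm (G (x k)))" for k
    using x_Suc G_ne[OF norm_x] by simp
  have descent: "c * (norm (x (Suc k) - x k))\<^sup>2 \<le> f (x k) - f (x (Suc k))" for k
    using bim_descent[OF sym norm_x assms(2) G_ne[OF norm_x, unfolded G_def], of "x (Suc k)" k] step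
    by (simp add: c_def f_def G_def)

  have decreasing: "f (x (Suc k)) < f (x k)" if "x (Suc k) \<noteq> x k" for k
  proof -
    have "0 < c * (norm (x (Suc k) - x k))\<^sup>2" using c that by simp
    with descent[of k] show ?thesis by linarith
  qed

  \<comment> \<open>The objective values decrease and are bounded below, so their consecutive
    differences tend to 0; by \<open>descent\<close> these dominate \<open>c\<close> times the
    squared steps.\<close>
  have tendsto: "(\<lambda>k. norm (x (Suc k) - x k)) \<longlonglongrightarrow> 0"
  proof -
    have "decseq (\<lambda>k. f (x k))"
      by (rule decseq_SucI) (metis decreasing order.strict_implies_order order_refl)
    moreover have "- norm B - 4 * \<alpha> \<le> f (x k)" for k
      unfolding f_def by (rule f_alpha_ge[OF sym norm_x assms(2)])
    ultimately obtain L where L: "(\<lambda>k. f (x k)) \<longlonglongrightarrow> L"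
      using decseq_convergent by blast
    have "(\<lambda>k. (f (x k) - f (x (Suc k))) / c) \<longlonglongrightarrow> (L - L) / c"
      by (intro tendsto_intros L LIMSEQ_Suc[OF L]) (use c in auto)
    then have lim: "(\<lambda>k. (f (x k) - f (x (Suc k))) / c) \<longlonglongrightarrow> 0" by simp
    have "(\<lambda>k. (norm (x (Suc k) - x k))\<^sup>2) \<longlonglongrightarrow> 0"
      by (rule tendsto_sandwich[OF _ _ tendsto_const lim])
        (use descent c in \<open>auto simp: field_simps\<close>)
    from tendsto_real_sqrt[OF this] show ?thesis by simp
  qed

  have kkt: "kkt_point \<theta> B \<alpha> p" if "cluster_point x p" for p
  proof -
    from that obtain r where r: "strict_mono r" and lim: "(\<lambda>k. x (r k)) \<longlonglongrightarrow> p"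
      by (auto simp: cluster_point_def o_def)
    have "(\<lambda>k. norm (x (r k))) \<longlonglongrightarrow> norm p" by (intro tendsto_intros lim)
    then have p: "norm p = 1" by (simp add: norm_x LIMSEQ_const_iff)
    have "(\<lambda>k. x (Suc (r k)) - x (r k)) \<longlonglongrightarrow> 0"
      using LIMSEQ_subseq_LIMSEQ[OF tendsto r] by (simp add: o_def tendsto_norm_zero_iff)
    \<comment> \<open>The shifted subsequence has the same limit because the steps vanish.
      Continuity of the update map at \<open>p\<close>, where \<open>G p\<close> is nonzero, gives a
      second expression for this limit, so \<open>p\<close> is a fixed point.\<close>
    from tendsto_add[OF this lim] have 1: "(\<lambda>k. x (Suc (r k))) \<longlonglongrightarrow> p" by simp
    have "isCont G p"
      using continuous_grad_f[of \<theta> B \<alpha>] by (simp add: G_def continuous_on_eq_continuous_at)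
    then have "(\<lambda>k. G (x (r k))) \<longlonglongrightarrow> G p" by (rule isCont_tendsto_compose) (rule lim)
    then have "(\<lambda>k. x (Suc (r k))) \<longlonglongrightarrow> - (G p /\<^sub>R norm (G p))"
      unfolding step by (intro tendsto_intros) (use G_ne[OF p] in auto)
    from LIMSEQ_unique[OF 1 this] have "p = - (G p /\<^sub>R norm (G p))" .
    then have "norm (G p) *\<^sub>R p = - G p"
      using G_ne[OF p] by (metis norm_eq_zero scaleR_minus_right scaleR_one scaleR_scaleR right_inverse)
    \<comment> \<open>The multiplier is \<open>- norm (G p) / 2\<close>; the halving matches the
      factor 2 in \<open>kkt_point\<close>.\<close>
    then have "G p = (2 * (- norm (G p) / 2)) *\<^sub>R p" by simp
    then show ?thesis
      using p unfolding kkt_point_def gradient_f_alpha[OF sym] G_def by blast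
  qed

  show ?thesis
    using decreasing tendsto kkt unfolding f_def by blast
qed

end
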